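(* Let $H$ be a Hadamard matrix of type $H(n,p)$, and let $u_1,u_2,\ldots,u_n$ be the columns of $G=\frac{1}{\sqrt n}H$. Put $E_i=u_iu_i^*$ for $1\le i\le n$. Then $\{E_1,E_2,\ldots,E_n\}$ is a COSI set of $n\times n$ matrices, the reverse circulant block matrix $$W=\begin{pmatrix} E_1 & E_2 & \cdots & E_{n-1} & E_n\\ E_2 & E_3 & \cdots & E_n & E_1\\ \vdots & \vdots & & \vdots & \vdots\\ E_n & E_1 & \cdots & E_{n-2} & E_{n-1}\end{pmatrix}$$ is a symmetric unitary $n^2\times n^2$ matrix each of whose entries is $\frac1n$ times a $p$-th root of $1$, and $nW$ is a symmetric $n^2\times n^2$ Hadamard matrix of type $H(n^2,p)$.
   Context: For a complex matrix $A$, $A^*$ denotes the complex conjugate transpose. A matrix $A$ is called symmetric if $A^*=A$ (i.e. Hermitian), and a square matrix $A$ is unitary if $AA^*=I$. A Hadamard matrix of type $H(n,p)$ is an $n\times n$ complex matrix $H$ each of whose entries is a $p$-th root of $1$ and which satisfies $HH^*=nI_n$. A matrix $E$ is idempotent if $E^2=E$. A complete orthogonal symmetric idempotent (COSI) set of $n\times n$ matrices is a set $\{E_1,\ldots,E_k\}$ of symmetric idempotent $n\times n$ matrices with $E_iE_j=0$ for $i\ne j$ and $E_1+\cdots+E_k=I_n$. In the reverse circulant block matrix, each block row is obtained from the previous one by a cyclic shift one place to the left (the $(i,j)$ block is $E_l$ with $l\equiv i+j-1 \pmod n$, $1\le l\le n$). *)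

theory Defs
  imports "Jordan_Normal_Form.Schur_Decomposition"
begin

definition symmetric_cmat :: "complex mat \<Rightarrow> bool" where
  "symmetric_cmat A \<longleftrightarrow> mat_adjoint A = A"

definition unitary_cmat :: "complex mat \<Rightarrow> bool" where
  "unitary_cmat A \<longleftrightarrow> square_mat A \<and> A * mat_adjoint A = 1\<^sub>m (dim_row A)"

text \<open>Type \<open>H(n,p)\<close>. The conditions \<open>0 < n\<close> and \<open>0 < p\<close> are implicit in the notion; for
  \<open>p = 0\<close> the equation \<open>z ^ p = 1\<close> would hold for every \<open>z\<close>.\<close>

definition hadamard_type :: "nat \<Rightarrow> nat \<Rightarrow> complex mat \<Rightarrow> bool" where
  "hadamard_type n p H \<longleftrightarrow>
     0 < n \<and> 0 < p \<and> H \<in> carrier_mat n n \<and>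
     (\<forall>i<n. \<forall>j<n. (H $$ (i, j)) ^ p = 1) \<and>
     H * mat_adjoint H = of_nat n \<cdot>\<^sub>m 1\<^sub>m n"

text \<open>The set \<open>{E\<^sub>1, \<dots>, E\<^sub>k}\<close> is represented by the family \<open>E 0, \<dots>, E (k - 1)\<close>, so that
  orthogonality is required for distinct indices and the sum runs over the indices.\<close>

definition COSI :: "nat \<Rightarrow> nat \<Rightarrow> (nat \<Rightarrow> complex mat) \<Rightarrow> bool" where
  "COSI n k E \<longleftrightarrow>
     (\<forall>i<k. E i \<in> carrier_mat n n \<and> symmetric_cmat (E i) \<and> E i * E i = E i) \<and>
     (\<forall>i<k. \<forall>j<k. i \<noteq> j \<longrightarrow> E i * E j = 0\<^sub>m n n) \<and>
     finsum (ring_mat TYPE(complex) n ()) E {..<k} = 1\<^sub>m n"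

text \<open>The \<open>n * m\<close> square matrix of \<open>n * n\<close> blocks, each \<open>m * m\<close>. Everything is 0-based: block
  \<open>(i, j)\<close> is \<open>E ((i + j) mod n)\<close>, which is the block with 1-based index congruent to
  \<open>i' + j' - 1\<close> at the 1-based block position \<open>i' = i + 1\<close>, \<open>j' = j + 1\<close>.\<close>

definition reverse_circulant_block :: "nat \<Rightarrow> nat \<Rightarrow> (nat \<Rightarrow> complex mat) \<Rightarrow> complex mat" where
  "reverse_circulant_block n m E =
     mat (n * m) (n * m)
       (\<lambda>(a, b). E ((a div m + b div m) mod n) $$ (a mod m, b mod m))"

definition column_mat :: "complex vec \<Rightarrow> complex mat" where
  "column_mat u = mat_of_cols (dim_vec u) [u]"

end

theory Submission
  imports Defs "HOL-Number_Theory.Cong"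
begin

text \<open>
  The columns of \<open>G\<close> form an orthonormal basis, because a square matrix with orthonormal rows
  also has orthonormal columns. The \<open>E i\<close> are therefore the orthogonal projections onto the
  lines spanned by this basis: \<open>E i * E j\<close> collapses through the scalar product of \<open>u i\<close> and
  \<open>u j\<close>, and the sum of the \<open>E i\<close> is \<open>G * mat_adjoint G\<close>, the identity
  (\<open>COSI_rank_one_projections\<close>).

  The reverse circulant of any COSI family is symmetric and unitary. Its block at \<open>(i, j)\<close>
  depends on \<open>i + j\<close> only and is itself symmetric, hence the whole matrix is symmetric. The block
  of \<open>W * mat_adjoint W\<close> at \<open>(i, j)\<close> is the sum over \<open>k\<close> of
  \<open>E ((i + k) mod n) * E ((j + k) mod n)\<close>. For \<open>i \<noteq> j\<close> each term pairs two different
  idempotents and vanishes; for \<open>i = j\<close> the shift by \<open>i\<close> permutes the indices and the block is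
  the sum of all idempotents, the identity (\<open>unitary_reverse_circulant_block\<close>).

  Finally every entry of \<open>E i\<close> is \<open>1 / n\<close> times \<open>h * cnj h'\<close> for two entries \<open>h\<close>, \<open>h'\<close> of \<open>H\<close>,
  and conjugates and products of \<open>p\<close>-th roots of unity are again such roots. So the blocks, and
  with them \<open>W\<close>, inherit the required shape of the entries.
\<close>

section \<open>Entries of adjoints, products and sums\<close>

lemma mat_adjoint_carrier [simp]:
  "A \<in> carrier_mat r c \<Longrightarrow> mat_adjoint A \<in> carrier_mat c r"
  unfolding mat_adjoint_def by auto

lemma dim_mat_adjoint [simp]:
  "dim_row (mat_adjoint A) = dim_col A" "dim_col (mat_adjoint A) = dim_row A"
  unfolding mat_adjoint_def by auto

lemma index_mat_adjoint:
  fixes A :: "complex mat"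
  assumes "A \<in> carrier_mat r c" "i < c" "j < r"
  shows "mat_adjoint A $$ (i, j) = cnj (A $$ (j, i))"
  using assms unfolding mat_adjoint_def by (auto simp: mat_of_rows_index)

lemma index_mult_mat_sum:
  fixes A B :: "complex mat"
  assumes "A \<in> carrier_mat r m" "B \<in> carrier_mat m c" "i < r" "j < c"
  shows "(A * B) $$ (i, j) = (\<Sum>k<m. A $$ (i, k) * B $$ (k, j))"
  using assms by (auto simp: scalar_prod_def lessThan_atLeast0 intro!: sum.cong)

lemma finsum_mat_carrier:
  fixes E :: "nat \<Rightarrow> complex mat"
  assumes "\<And>i. i < k \<Longrightarrow> E i \<in> carrier_mat m m"
  shows "finsum (ring_mat TYPE(complex) m ()) E {..<k} \<in> carrier_mat m m"
proof -
  interpret R: ring "ring_mat TYPE(complex) m ()"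
    by (rule ring_mat)
  show ?thesis
    using R.finsum_closed[of E "{..<k}"] assms by (auto simp: ring_mat_simps)
qed

lemma index_finsum_mat:
  fixes E :: "nat \<Rightarrow> complex mat"
  assumes "\<And>i. i < k \<Longrightarrow> E i \<in> carrier_mat m m" "a < m" "b < m"
  shows "finsum (ring_mat TYPE(complex) m ()) E {..<k} $$ (a, b) = (\<Sum>i<k. E i $$ (a, b))"
  using assms(1)
proof (induction k)
  interpret R: ring "ring_mat TYPE(complex) m ()"
    by (rule ring_mat)
  case 0
  show ?case
    using assms(2,3) by (simp add: ring_mat_simps)
next
  interpret R: ring "ring_mat TYPE(complex) m ()"
    by (rule ring_mat)
  case (Suc k)
  have "finsum (ring_mat TYPE(complex) m ()) E {..<Suc k} =
      E k + finsum (ring_mat TYPE(complex) m ()) E {..<k}"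
    using R.finsum_insert[of "{..<k}" k E] Suc.prems
    by (auto simp: lessThan_Suc ring_mat_simps)
  moreover have "finsum (ring_mat TYPE(complex) m ()) E {..<k} \<in> carrier_mat m m"
    using Suc.prems by (intro finsum_mat_carrier) auto
  ultimately show ?case
    using Suc assms(2,3) by (simp add: add.commute)
qed

section \<open>Rank-one projections onto an orthonormal basis\<close>

text \<open>The sum in the first equation is an entry of \<open>G * mat_adjoint G\<close> and that in the second an
  entry of \<open>mat_adjoint G * G\<close>. The second uses that a one-sided inverse of a square matrix is
  two-sided.\<close>

lemma unitary_rows_columns:
  assumes "G \<in> carrier_mat n n" "unitary_cmat G" "i < n" "j < n"
  shows "(\<Sum>k<n. G $$ (i, k) * cnj (G $$ (j, k))) = (if i = j then 1 else 0)"
    and "(\<Sum>k<n. cnj (G $$ (k, i)) * G $$ (k, j)) = (if i = j then 1 else 0)"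
proof -
  have GG: "G * mat_adjoint G = 1\<^sub>m n"
    using assms(1,2) by (auto simp: unitary_cmat_def)
  have adj: "mat_adjoint G \<in> carrier_mat n n"
    using assms(1) by simp
  have "(G * mat_adjoint G) $$ (i, j) = (\<Sum>k<n. G $$ (i, k) * cnj (G $$ (j, k)))"
    using assms by (subst index_mult_mat_sum[OF assms(1) adj])
      (auto simp: index_mat_adjoint[OF assms(1)])
  then show "(\<Sum>k<n. G $$ (i, k) * cnj (G $$ (j, k))) = (if i = j then 1 else 0)"
    using assms GG by simp
  have "(mat_adjoint G * G) $$ (i, j) = (\<Sum>k<n. cnj (G $$ (k, i)) * G $$ (k, j))"
    using assms by (subst index_mult_mat_sum[OF adj assms(1)])
      (auto simp: index_mat_adjoint[OF assms(1)])
  then show "(\<Sum>k<n. cnj (G $$ (k, i)) * G $$ (k, j)) = (if i = j then 1 else 0)"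
    using assms mat_mult_left_right_inverse[OF assms(1) adj GG] by simp
qed

lemma rank_one_carrier:
  "column_mat v * mat_adjoint (column_mat v) \<in> carrier_mat (dim_vec v) (dim_vec v)"
proof -
  have "column_mat v \<in> carrier_mat (dim_vec v) 1"
    by (auto simp: column_mat_def)
  then show ?thesis
    by (metis mat_adjoint_carrier mult_carrier_mat)
qed

lemma index_rank_one:
  assumes "a < dim_vec v" "b < dim_vec v"
  shows "(column_mat v * mat_adjoint (column_mat v)) $$ (a, b) = v $ a * cnj (v $ b)"
proof -
  have c: "column_mat v \<in> carrier_mat (dim_vec v) 1"
    by (auto simp: column_mat_def)
  have "column_mat v $$ (k, 0) = v $ k" if "k < dim_vec v" for k
    using that by (simp add: column_mat_def mat_of_cols_index)
  then show ?thesis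
    using assms by (subst index_mult_mat_sum[OF c mat_adjoint_carrier[OF c]])
      (auto simp: index_mat_adjoint[OF c])
qed

text \<open>In \<open>E i * E j\<close> the inner sum is the scalar product of columns \<open>i\<close> and \<open>j\<close> of \<open>G\<close>, so
  orthonormality of the columns gives idempotence and orthogonality. Completeness is instead
  orthonormality of the rows, since summing over \<open>i\<close> contracts the column index.\<close>

lemma COSI_rank_one_projections:
  assumes G: "G \<in> carrier_mat n n" and unit: "unitary_cmat G"
    and E: "\<And>i. i < n \<Longrightarrow>
      E i = column_mat (col G i) * mat_adjoint (column_mat (col G i))"
  shows "COSI n n E"
proof -
  have car: "E i \<in> carrier_mat n n" if "i < n" for i
    using that G rank_one_carrier[of "col G i"] by (simp add: E)
  have ent: "E i $$ (a, b) = G $$ (a, i) * cnj (G $$ (b, i))"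
    if "i < n" "a < n" "b < n" for i a b
    using that G by (simp add: E index_rank_one)
  have sym: "symmetric_cmat (E i)" if "i < n" for i
    unfolding symmetric_cmat_def using car[OF that] that
    by (intro eq_matI) (auto simp: index_mat_adjoint[OF car[OF that]] ent)
  have prod: "(E i * E j) $$ (a, b) = (if i = j then E i $$ (a, b) else 0)"
    if "i < n" "j < n" "a < n" "b < n" for i j a b
  proof -
    have "(E i * E j) $$ (a, b) =
        (\<Sum>k<n. G $$ (a, i) * cnj (G $$ (k, i)) * (G $$ (k, j) * cnj (G $$ (b, j))))"
      using that by (subst index_mult_mat_sum[OF car car]) (auto simp: ent)
    also have "\<dots> = G $$ (a, i) * (\<Sum>k<n. cnj (G $$ (k, i)) * G $$ (k, j)) * cnj (G $$ (b, j))"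
      by (simp add: sum_distrib_left sum_distrib_right mult_ac)
    also have "\<dots> = (if i = j then E i $$ (a, b) else 0)"
      using that unitary_rows_columns(2)[OF G unit, of i j] by (simp add: ent)
    finally show ?thesis .
  qed
  have idem: "E i * E i = E i" if "i < n" for i
    using car[OF that] that by (intro eq_matI) (auto simp: prod simp del: index_mult_mat(1))
  have orth: "E i * E j = 0\<^sub>m n n" if "i < n" "j < n" "i \<noteq> j" for i j
    using car[OF that(1)] car[OF that(2)] that
    by (intro eq_matI) (auto simp: prod simp del: index_mult_mat(1))
  have "finsum (ring_mat TYPE(complex) n ()) E {..<n} = 1\<^sub>m n"
    using finsum_mat_carrier[of n E n, OF car] unitary_rows_columns(1)[OF G unit]
    by (intro eq_matI) (auto simp: index_finsum_mat[OF car] ent)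
  with car sym idem orth show ?thesis
    by (auto simp: COSI_def)
qed

section \<open>Reverse circulants of COSI families\<close>

lemma block_position:
  fixes a n m :: nat
  assumes "a < n * m"
  shows "a div m < n" "a mod m < m"
  using assms by (auto simp: less_mult_imp_div_less intro!: mod_less_divisor Nat.gr0I)

lemma sum_blocks:
  fixes f :: "nat \<Rightarrow> complex"
  shows "(\<Sum>c<n * m. f c) = (\<Sum>k<n. \<Sum>r<m. f (k * m + r))"
proof -
  have "(\<Sum>c\<in>{k * m..<k * m + m}. f c) = (\<Sum>r<m. f (k * m + r))" for k
    by (rule sum.reindex_bij_witness[of _ "\<lambda>r. k * m + r" "\<lambda>c. c - k * m"]) auto
  then show ?thesis
    by (simp flip: sum.nat_group)
qed

text \<open>Injectivity serves twice below: two different block rows never meet the same idempotent in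
  the same block column, and along one block row every idempotent occurs exactly once.\<close>

lemma inj_on_shift_mod:
  fixes i n :: nat
  shows "inj_on (\<lambda>k. (i + k) mod n) {..<n}"
proof (rule inj_onI)
  fix x y assume "x \<in> {..<n}" "y \<in> {..<n}" "(i + x) mod n = (i + y) mod n"
  then show "x = y"
    using cong_add_lcancel_nat[of i x y n] by (simp add: cong_def)
qed

lemma sum_shift_mod:
  fixes f :: "nat \<Rightarrow> complex"
  shows "(\<Sum>k<n. f ((i + k) mod n)) = (\<Sum>k<n. f k)"
proof -
  have "(\<lambda>k. (i + k) mod n) ` {..<n} = {..<n}"
    by (rule endo_inj_surj) (auto simp: inj_on_shift_mod)
  then have "bij_betw (\<lambda>k. (i + k) mod n) {..<n} {..<n}"
    using inj_on_shift_mod[of i n] by (simp add: bij_betw_def)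
  then show ?thesis
    by (rule sum.reindex_bij_betw)
qed

lemma reverse_circulant_block_carrier [simp]:
  "reverse_circulant_block n m E \<in> carrier_mat (n * m) (n * m)"
  by (simp add: reverse_circulant_block_def)

lemma dim_reverse_circulant_block [simp]:
  "dim_row (reverse_circulant_block n m E) = n * m"
  "dim_col (reverse_circulant_block n m E) = n * m"
  by (simp_all add: reverse_circulant_block_def)

lemma index_reverse_circulant_block:
  "a < n * m \<Longrightarrow> b < n * m \<Longrightarrow> reverse_circulant_block n m E $$ (a, b) =
    E ((a div m + b div m) mod n) $$ (a mod m, b mod m)"
  by (simp add: reverse_circulant_block_def)

lemma symmetric_cmat_entry:
  assumes "symmetric_cmat A" "A \<in> carrier_mat m m" "a < m" "b < m"
  shows "cnj (A $$ (a, b)) = A $$ (b, a)"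
  using index_mat_adjoint[OF assms(2,4,3)] assms(1) by (simp add: symmetric_cmat_def)

lemma symmetric_reverse_circulant_block:
  assumes "COSI m n E"
  shows "symmetric_cmat (reverse_circulant_block n m E)"
proof -
  let ?W = "reverse_circulant_block n m E"
  have W: "?W \<in> carrier_mat (n * m) (n * m)"
    by simp
  have "mat_adjoint ?W $$ (a, b) = ?W $$ (a, b)" if "a < n * m" "b < n * m" for a b
  proof -
    let ?l = "(b div m + a div m) mod n"
    have "?l < n"
      using block_position[OF that(1)] by (auto intro!: mod_less_divisor)
    then have "cnj (E ?l $$ (b mod m, a mod m)) = E ?l $$ (a mod m, b mod m)"
      using assms that
      by (intro symmetric_cmat_entry[where m = m]) (auto simp: COSI_def block_position)
    then show ?thesis
      using that by (simp add: index_mat_adjoint[OF W] index_reverse_circulant_block add.commute)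
  qed
  then show ?thesis
    unfolding symmetric_cmat_def by (intro eq_matI) auto
qed

text \<open>By symmetry it is enough to square the matrix, so that no adjoints of blocks appear. Block
  \<open>(i, j)\<close> of the square is a sum of products of two idempotents, which orthogonality kills
  unless \<open>i = j\<close>; the diagonal blocks add up all idempotents in a shifted order.\<close>

lemma unitary_reverse_circulant_block:
  assumes "COSI m n E"
  shows "unitary_cmat (reverse_circulant_block n m E)"
proof -
  let ?W = "reverse_circulant_block n m E"
  have W: "?W \<in> carrier_mat (n * m) (n * m)"
    by simp
  have car: "E i \<in> carrier_mat m m" and idem: "E i * E i = E i" if "i < n" for i
    using assms that by (auto simp: COSI_def)
  have orth: "E i * E j = 0\<^sub>m m m" if "i < n" "j < n" "i \<noteq> j" for i j
    using assms that by (auto simp: COSI_def)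
  have total: "finsum (ring_mat TYPE(complex) m ()) E {..<n} = 1\<^sub>m m"
    using assms by (auto simp: COSI_def)
  have "(?W * ?W) $$ (a, b) = (1\<^sub>m (n * m)) $$ (a, b)" if ab: "a < n * m" "b < n * m" for a b
  proof -
    define i r j s where "i = a div m" "r = a mod m" "j = b div m" "s = b mod m"
    note ijrs = i_r_j_s_def
    have pos: "i < n" "r < m" "j < n" "s < m"
      using block_position[OF ab(1)] block_position[OF ab(2)] by (auto simp: ijrs)
    have ab_eq: "a = b \<longleftrightarrow> i = j \<and> r = s"
      unfolding ijrs by (metis div_mult_mod_eq)
    have "(?W * ?W) $$ (a, b) = (\<Sum>c<n * m. ?W $$ (a, c) * ?W $$ (c, b))"
      using ab by (intro index_mult_mat_sum[OF W W])
    also have "\<dots> = (\<Sum>k<n. \<Sum>t<m. ?W $$ (a, k * m + t) * ?W $$ (k * m + t, b))"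
      by (rule sum_blocks)
    also have "\<dots> = (\<Sum>k<n. (E ((i + k) mod n) * E ((j + k) mod n)) $$ (r, s))"
    proof (rule sum.cong[OF refl])
      fix k assume "k \<in> {..<n}"
      then have "k < n" by simp
      then have c: "k * m + t < n * m" if "t < m" for t
        using that mult_le_mono1[of "Suc k" n m] by simp
      have l: "(i + k) mod n < n" "(j + k) mod n < n"
        using \<open>k < n\<close> by auto
      have "(E ((i + k) mod n) * E ((j + k) mod n)) $$ (r, s) =
          (\<Sum>t<m. E ((i + k) mod n) $$ (r, t) * E ((j + k) mod n) $$ (t, s))"
        using l pos by (intro index_mult_mat_sum[OF car car])
      also have "\<dots> = (\<Sum>t<m. ?W $$ (a, k * m + t) * ?W $$ (k * m + t, b))"
        using ab c by (intro sum.cong) (auto simp: index_reverse_circulant_block ijrs add.commute)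
      finally show "(\<Sum>t<m. ?W $$ (a, k * m + t) * ?W $$ (k * m + t, b)) =
          (E ((i + k) mod n) * E ((j + k) mod n)) $$ (r, s)" by simp
    qed
    also have "\<dots> = (if i = j \<and> r = s then 1 else 0)"
    proof (cases "i = j")
      case True
      have "(\<Sum>k<n. (E ((i + k) mod n) * E ((j + k) mod n)) $$ (r, s)) =
          (\<Sum>k<n. E ((i + k) mod n) $$ (r, s))"
        using pos by (intro sum.cong) (auto simp: True idem)
      also have "\<dots> = (\<Sum>l<n. E l $$ (r, s))"
        by (rule sum_shift_mod)
      also have "\<dots> = (1\<^sub>m m) $$ (r, s)"
        using index_finsum_mat[of n E m r s] car pos total by simp
      finally show ?thesis
        using True pos by simp
    next
      case False
      have "(i + k) mod n \<noteq> (j + k) mod n" for k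
        using inj_onD[OF inj_on_shift_mod[of k n], of i j] pos False by (auto simp: add.commute)
      then have "(E ((i + k) mod n) * E ((j + k) mod n)) $$ (r, s) = 0" if "k < n" for k
        using that pos by (subst orth) auto
      with False show ?thesis
        by simp
    qed
    finally show ?thesis
      using ab by (simp add: ab_eq)
  qed
  then have "?W * ?W = 1\<^sub>m (n * m)"
    using W by (intro eq_matI) auto
  moreover have "mat_adjoint ?W = ?W"
    using symmetric_reverse_circulant_block[OF assms] by (simp add: symmetric_cmat_def)
  ultimately show ?thesis
    using W by (simp add: unitary_cmat_def)
qed

section \<open>Scaling, and Hadamard matrices\<close>

lemma mat_adjoint_smult:
  fixes A :: "complex mat"
  assumes A: "A \<in> carrier_mat r c"
  shows "mat_adjoint (x \<cdot>\<^sub>m A) = cnj x \<cdot>\<^sub>m mat_adjoint A"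
proof -
  have xA: "x \<cdot>\<^sub>m A \<in> carrier_mat r c"
    using A by simp
  show ?thesis
    using A
    by (intro eq_matI) (auto simp: index_mat_adjoint[OF A] index_mat_adjoint[OF xA])
qed

lemma smult_smult_mat:
  fixes A :: "complex mat"
  shows "x \<cdot>\<^sub>m (y \<cdot>\<^sub>m A) = (x * y) \<cdot>\<^sub>m A"
  by (intro eq_matI) auto

lemma smult_mult_adjoint:
  fixes A :: "complex mat"
  assumes A: "A \<in> carrier_mat r c"
  shows "(x \<cdot>\<^sub>m A) * mat_adjoint (x \<cdot>\<^sub>m A) = (x * cnj x) \<cdot>\<^sub>m (A * mat_adjoint A)"
proof -
  have B: "mat_adjoint A \<in> carrier_mat c r"
    using A by simp
  have "(x \<cdot>\<^sub>m A) * (cnj x \<cdot>\<^sub>m mat_adjoint A) = x \<cdot>\<^sub>m (cnj x \<cdot>\<^sub>m (A * mat_adjoint A))"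
    using mult_smult_assoc_mat[OF A smult_carrier_mat[OF B]] mult_smult_distrib[OF A B] by simp
  then show ?thesis
    by (simp add: mat_adjoint_smult[OF A] smult_smult_mat)
qed

lemma complex_inverse_sqrt_squared:
  "complex_of_real (1 / sqrt (real n)) * complex_of_real (1 / sqrt (real n)) = 1 / of_nat n"
proof -
  have "1 / sqrt (real n) * (1 / sqrt (real n)) = 1 / real n"
    by simp
  then show ?thesis
    by (metis of_real_mult of_real_divide of_real_1 of_real_of_nat_eq)
qed

lemma unitary_scaled_hadamard:
  assumes "hadamard_type n p H"
  shows "unitary_cmat (complex_of_real (1 / sqrt (real n)) \<cdot>\<^sub>m H)"
proof -
  have n: "0 < n" and H: "H \<in> carrier_mat n n"
    and HH: "H * mat_adjoint H = of_nat n \<cdot>\<^sub>m 1\<^sub>m n"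
    using assms by (auto simp: hadamard_type_def)
  let ?x = "complex_of_real (1 / sqrt (real n))"
  have "?x * cnj ?x * of_nat n = 1"
    using n complex_inverse_sqrt_squared[of n] by (simp only: complex_cnj_complex_of_real) simp
  then have "(?x \<cdot>\<^sub>m H) * mat_adjoint (?x \<cdot>\<^sub>m H) = 1\<^sub>m n"
    unfolding smult_mult_adjoint[OF H] HH smult_smult_mat by (auto intro: eq_matI)
  then show ?thesis
    using H by (simp add: unitary_cmat_def)
qed

theorem mainTheorem6:
  fixes H G W :: "complex mat" and n p :: nat
    and u :: "nat \<Rightarrow> complex vec" and E :: "nat \<Rightarrow> complex mat"
  assumes "hadamard_type n p H"
    and "G = complex_of_real (1 / sqrt (real n)) \<cdot>\<^sub>m H"
    and "\<And>i. i < n \<Longrightarrow> u i = col G i"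
    and "\<And>i. i < n \<Longrightarrow> E i = column_mat (u i) * mat_adjoint (column_mat (u i))"
    and "W = reverse_circulant_block n n E"
  shows "COSI n n E \<and>
    W \<in> carrier_mat (n\<^sup>2) (n\<^sup>2) \<and> symmetric_cmat W \<and> unitary_cmat W \<and>
    (\<forall>i<n\<^sup>2. \<forall>j<n\<^sup>2. \<exists>z. z ^ p = 1 \<and> W $$ (i, j) = 1 / of_nat n * z) \<and>
    symmetric_cmat (of_nat n \<cdot>\<^sub>m W) \<and>
    hadamard_type (n\<^sup>2) p (of_nat n \<cdot>\<^sub>m W)"
proof -
  have n: "0 < n" and p: "0 < p" and H: "H \<in> carrier_mat n n"
    and root: "\<And>i j. i < n \<Longrightarrow> j < n \<Longrightarrow> (H $$ (i, j)) ^ p = 1"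
    using assms(1) by (auto simp: hadamard_type_def)
  have G: "G \<in> carrier_mat n n"
    using H assms(2) by simp
  have COSI: "COSI n n E"
    using unitary_scaled_hadamard[OF assms(1), folded assms(2)] assms(3,4)
    by (intro COSI_rank_one_projections[OF G]) simp_all
  have W: "W \<in> carrier_mat (n\<^sup>2) (n\<^sup>2)"
    unfolding assms(5) power2_eq_square by simp
  have sym: "symmetric_cmat W" and unit: "unitary_cmat W"
    unfolding assms(5)
    using COSI symmetric_reverse_circulant_block unitary_reverse_circulant_block by auto
  have blocks: "\<exists>z. z ^ p = 1 \<and> E i $$ (a, b) = 1 / of_nat n * z"
    if "i < n" "a < n" "b < n" for i a b
  proof (intro exI conjI)
    show "(H $$ (a, i) * cnj (H $$ (b, i))) ^ p = 1"
      using that by (simp add: power_mult_distrib root flip: complex_cnj_power)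
    have "E i $$ (a, b) = complex_of_real (1 / sqrt (real n)) *
        complex_of_real (1 / sqrt (real n)) * (H $$ (a, i) * cnj (H $$ (b, i)))"
      using that G H by (simp add: assms(2-4) index_rank_one)
    then show "E i $$ (a, b) = 1 / of_nat n * (H $$ (a, i) * cnj (H $$ (b, i)))"
      by (simp only: complex_inverse_sqrt_squared)
  qed
  have entries: "\<exists>z. z ^ p = 1 \<and> W $$ (a, b) = 1 / of_nat n * z"
    if "a < n\<^sup>2" "b < n\<^sup>2" for a b
    using that blocks[of "(a div n + b div n) mod n" "a mod n" "b mod n"] n
    by (simp add: assms(5) index_reverse_circulant_block power2_eq_square)
  have sym_nW: "symmetric_cmat (of_nat n \<cdot>\<^sub>m W)"
    using sym by (simp add: symmetric_cmat_def mat_adjoint_smult[OF W])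
  have roots_nW: "((of_nat n \<cdot>\<^sub>m W) $$ (a, b)) ^ p = 1" if "a < n\<^sup>2" "b < n\<^sup>2" for a b
    using entries[OF that] that W n by auto
  have "(of_nat n \<cdot>\<^sub>m W) * mat_adjoint (of_nat n \<cdot>\<^sub>m W) = of_nat (n\<^sup>2) \<cdot>\<^sub>m 1\<^sub>m (n\<^sup>2)"
    using unit W by (simp add: smult_mult_adjoint[OF W] unitary_cmat_def power2_eq_square)
  then have "hadamard_type (n\<^sup>2) p (of_nat n \<cdot>\<^sub>m W)"
    using n p W roots_nW by (simp add: hadamard_type_def)
  with COSI W sym unit entries sym_nW show ?thesis
    by blast
qed

end
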